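(* Let $G_1=g_1S_-^2+g_2S_-q^{-s_3}+g_3S_-q^{s_3}+g_2'S_+q^{-s_3}+g_3'S_+q^{s_3}+g_4q^{2s_3}+g_5q^{-2s_3}+g_6$ be the element $qW_1W_0-q^{-1}W_0W_1$ of $\mathfrak U_q(sl(2))$ described in the context, acting in the $q$-difference operator realization. For the specialization $g_2'=g_3'=g_1=0$ (obtained by choosing $c_0=\bar c_1=\mu_0=0$), the reduced operator $\tilde G_1=G_1|_{g_2'=g_3'=g_1=0}$ is diagonalized by the little $q$-Jacobi polynomials $p_n(z;\mathfrak a,\mathfrak b;q^2)$.
   Context: $q$ is a nonzero complex number, not a root of unity. $\mathfrak U_q(sl(2))$ is generated by $S_\pm$ and $q^{\pm s_3}$ with $q^{s_3}S_\pm=q^{\pm1}S_\pm q^{s_3}$, $[S_+,S_-]=\frac{q^{2s_3}-q^{-2s_3}}{q-q^{-1}}$, and has Casimir element $\Omega=\frac{q^{-1}q^{2s_3}+q\,q^{-2s_3}}{(q-q^{-1})^2}+S_+S_-$. For scalars $c_i,\bar c_i,\epsilon_i,\mu_i$ ($i=0,1$), $$W_0=c_0S_+q^{s_3}+\bar c_0S_-q^{s_3}+\epsilon_0q^{2s_3}+\mu_0,\qquad W_1=c_1S_+q^{-s_3}+\bar c_1S_-q^{-s_3}+\epsilon_1q^{-2s_3}+\mu_1,$$ and the coefficients of $G_1=qW_1W_0-q^{-1}W_0W_1$ are $$g_1=\bar c_0\bar c_1(q^2-q^{-2}),\quad g_2=\bar c_0\epsilon_1(q^2-q^{-2})q+\mu_0\bar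 c_1(q-q^{-1}),\quad g_3=\bar c_1\epsilon_0(q^2-q^{-2})q^{-1}+\mu_1\bar c_0(q-q^{-1}),$$ $$g_2'=\mu_0c_1(q-q^{-1}),\quad g_3'=\mu_1c_0(q-q^{-1}),\quad g_4=-\frac{c_0\bar c_1q^{-1}(q+q^{-1})}{q-q^{-1}}+\mu_1\epsilon_0(q-q^{-1}),$$ $$g_5=-\frac{c_1\bar c_0q(q+q^{-1})}{q-q^{-1}}+\mu_0\epsilon_1(q-q^{-1}),\quad g_6=(c_1\bar c_0q+c_0\bar c_1q^{-1})(q-q^{-1})\Omega+(\epsilon_0\epsilon_1+\mu_0\mu_1)(q-q^{-1}).$$ Realization ($2\nu\notin\mathbb Z_{\ge0}$) on formal power series in $z$, with $T_\pm f(z)=f(q^{\pm1}z)$: $$q^{s_3}\mapsto q^{-\nu}T_+,\quad q^{-s_3}\mapsto q^{\nu}T_-,\quad S_+\mapsto z\frac{q^{2\nu}T_--q^{-2\nu}T_+}{q-q^{-1}},\quad S_-\mapsto -z^{-1}\frac{T_--T_+}{q-q^{-1}},$$ under which $\Omega$ acts as the scalar $\frac{q^{2\nu+1}+q^{-2\nu-1}}{(q-q^{-1})^2}$. With $(a;q)_n=\prod_{k=0}^{n-1}(1-aq^k)$, the little $q$-Jacobi polynomials in base $q^2$ are $$p_n(z;\mathfrak a,\mathfrak b;q^2)=\sum_{m=0}^{n}\frac{(q^{-2n};q^2)_m(\mathfrak a\mathfrak b q^{2n+2};q^2)_m}{(q^2\mathfrak a;q^2)_m(q^2;q^2)_m}(q^2z)^m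 .$$ The statement itself does not specify how $\mathfrak a,\mathfrak b$ depend on the $g_i$; for information only, the argument for it uses $\mathfrak a=-\frac{g_3}{g_5}\frac{q^{-3\nu}}{q-q^{-1}}$, $\mathfrak b=-\frac{g_4}{g_3}(q-q^{-1})q^{-\nu-2}$, $\frac{g_2}{g_5}=(q-q^{-1})q^{\nu}$.
   Formalization: Assumes g_2, g_5 nonzero, g_4=0 if g_3=0, a q^{2k}≠1 (k≥1) and ab q^{2k}≠1 (k≥2); argument z is claimed only if g_2/g_5=(q-q^{-1})q^ν, otherwise z is rescaled to κz. Unrestricted claim fails, e.g. if g_2=g_3=g_4=0, g_5≠0 (monomial eigenvectors). *)

theory Defs
  imports
    "HOL-Library.Poly_Mapping"
    "HOL-Computational_Algebra.Polynomial_FPS"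
    "HOL-Analysis.Analysis"
begin

section \<open>The algebra $U_q(sl(2))$\<close>

text \<open>
  The free complex algebra on the generators $S_+$, $S_-$, $q^{s_3}$, $q^{-s_3}$ is the monoid algebra
  of the words in these letters.  Since the defining relations depend on the number \<open>q\<close>, the
  quotient $U_q(sl(2))$ is not a type; it is represented by the congruence \<open>uq_eq q\<close> modulo the
  two-sided ideal generated by the relations.
\<close>

datatype uq_letter = Splus | Sminus | Kplus | Kminus

datatype uq_word = Word (letters: "uq_letter list")

instantiation uq_word :: monoid_add
begin

definition zero_uq_word :: uq_word where
  "zero_uq_word = Word []"

definition plus_uq_word :: "uq_word \<Rightarrow> uq_word \<Rightarrow> uq_word" where
  "plus_uq_word u v = Word (letters u @ letters v)"

instance
  by standard (simp_all add: zero_uq_word_def plus_uq_word_def)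

end

type_synonym uq_free = "uq_word \<Rightarrow>\<^sub>0 complex"

definition scal :: "complex \<Rightarrow> uq_free" where
  "scal c = Poly_Mapping.single 0 c"

definition gen :: "uq_letter \<Rightarrow> uq_free" where
  "gen x = Poly_Mapping.single (Word [x]) 1"

abbreviation S_plus :: uq_free where "S_plus \<equiv> gen Splus"
abbreviation S_minus :: uq_free where "S_minus \<equiv> gen Sminus"
abbreviation K :: uq_free where "K \<equiv> gen Kplus"
abbreviation K' :: uq_free where "K' \<equiv> gen Kminus"

definition uq_relators :: "complex \<Rightarrow> uq_free set" where
  "uq_relators q =
    {K * K' - 1,
     K' * K - 1,
     K * S_plus - scal q * S_plus * K,
     K * S_minus - scal (inverse q) * S_minus * K,
     S_plus * S_minus - S_minus * S_plus - scal (inverse (q - inverse q)) * (K ^ 2 - K' ^ 2)}"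

inductive_set uq_ideal :: "complex \<Rightarrow> uq_free set" for q :: complex where
  zero: "0 \<in> uq_ideal q"
| step: "r \<in> uq_relators q \<Longrightarrow> s \<in> uq_ideal q \<Longrightarrow> x * r * y + s \<in> uq_ideal q"

definition uq_eq :: "complex \<Rightarrow> uq_free \<Rightarrow> uq_free \<Rightarrow> bool" where
  "uq_eq q x y \<longleftrightarrow> x - y \<in> uq_ideal q"

definition Casimir :: "complex \<Rightarrow> uq_free" where
  "Casimir q = scal (inverse ((q - inverse q) ^ 2)) * (scal (inverse q) * K ^ 2 + scal q * K' ^ 2)
     + S_plus * S_minus"


section \<open>The elements $W_0$, $W_1$, $G_1$\<close>

text \<open>The scalars $c_i$, $\bar c_i$, $\epsilon_i$, $\mu_i$ are the values at \<open>i = 0, 1\<close> of the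
  functions \<open>c\<close>, \<open>cb\<close>, \<open>e\<close>, \<open>m\<close>; no other value is used.\<close>

type_synonym scalars = "nat \<Rightarrow> complex"

definition W0 :: "scalars \<Rightarrow> scalars \<Rightarrow> scalars \<Rightarrow> scalars \<Rightarrow> uq_free" where
  "W0 c cb e m = scal (c 0) * S_plus * K + scal (cb 0) * S_minus * K + scal (e 0) * K ^ 2 + scal (m 0)"

definition W1 :: "scalars \<Rightarrow> scalars \<Rightarrow> scalars \<Rightarrow> scalars \<Rightarrow> uq_free" where
  "W1 c cb e m = scal (c 1) * S_plus * K' + scal (cb 1) * S_minus * K' + scal (e 1) * K' ^ 2 + scal (m 1)"

definition G1 :: "complex \<Rightarrow> scalars \<Rightarrow> scalars \<Rightarrow> scalars \<Rightarrow> scalars \<Rightarrow> uq_free" where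
  "G1 q c cb e m = scal q * W1 c cb e m * W0 c cb e m - scal (inverse q) * W0 c cb e m * W1 c cb e m"

definition g1 :: "complex \<Rightarrow> scalars \<Rightarrow> scalars \<Rightarrow> scalars \<Rightarrow> scalars \<Rightarrow> complex" where
  "g1 q c cb e m = cb 0 * cb 1 * (q ^ 2 - inverse q ^ 2)"

definition g2 :: "complex \<Rightarrow> scalars \<Rightarrow> scalars \<Rightarrow> scalars \<Rightarrow> scalars \<Rightarrow> complex" where
  "g2 q c cb e m = cb 0 * e 1 * (q ^ 2 - inverse q ^ 2) * q + m 0 * cb 1 * (q - inverse q)"

definition g3 :: "complex \<Rightarrow> scalars \<Rightarrow> scalars \<Rightarrow> scalars \<Rightarrow> scalars \<Rightarrow> complex" where
  "g3 q c cb e m = cb 1 * e 0 * (q ^ 2 - inverse q ^ 2) * inverse q + m 1 * cb 0 * (q - inverse q)"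

definition g2' :: "complex \<Rightarrow> scalars \<Rightarrow> scalars \<Rightarrow> scalars \<Rightarrow> scalars \<Rightarrow> complex" where
  "g2' q c cb e m = m 0 * c 1 * (q - inverse q)"

definition g3' :: "complex \<Rightarrow> scalars \<Rightarrow> scalars \<Rightarrow> scalars \<Rightarrow> scalars \<Rightarrow> complex" where
  "g3' q c cb e m = m 1 * c 0 * (q - inverse q)"

definition g4 :: "complex \<Rightarrow> scalars \<Rightarrow> scalars \<Rightarrow> scalars \<Rightarrow> scalars \<Rightarrow> complex" where
  "g4 q c cb e m = - (c 0 * cb 1 * inverse q * (q + inverse q) / (q - inverse q))
     + m 1 * e 0 * (q - inverse q)"

definition g5 :: "complex \<Rightarrow> scalars \<Rightarrow> scalars \<Rightarrow> scalars \<Rightarrow> scalars \<Rightarrow> complex" where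
  "g5 q c cb e m = - (c 1 * cb 0 * q * (q + inverse q) / (q - inverse q))
     + m 0 * e 1 * (q - inverse q)"

definition g6 :: "complex \<Rightarrow> scalars \<Rightarrow> scalars \<Rightarrow> scalars \<Rightarrow> scalars \<Rightarrow> uq_free" where
  "g6 q c cb e m = scal ((c 1 * cb 0 * q + c 0 * cb 1 * inverse q) * (q - inverse q)) * Casimir q
     + scal ((e 0 * e 1 + m 0 * m 1) * (q - inverse q))"


section \<open>The realization by $q$-difference operators\<close>

definition q_shift :: "complex \<Rightarrow> complex fps \<Rightarrow> complex fps" where
  "q_shift t f = fps_compose f (fps_const t * fps_X)"

text \<open>In the operator for $S_-$ the series divided by $z$ has vanishing constant term, so that
  \<open>fps_shift 1\<close> is the division by $z$.\<close>

fun realize_letter :: "complex \<Rightarrow> complex \<Rightarrow> uq_letter \<Rightarrow> complex fps \<Rightarrow> complex fps" where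
  "realize_letter q \<nu> Kplus f = fps_const (q powr (- \<nu>)) * q_shift q f"
| "realize_letter q \<nu> Kminus f = fps_const (q powr \<nu>) * q_shift (inverse q) f"
| "realize_letter q \<nu> Splus f =
     fps_X * (fps_const (inverse (q - inverse q)) *
       (fps_const (q powr (2 * \<nu>)) * q_shift (inverse q) f - fps_const (q powr (- (2 * \<nu>))) * q_shift q f))"
| "realize_letter q \<nu> Sminus f =
     - fps_shift 1 (fps_const (inverse (q - inverse q)) * (q_shift (inverse q) f - q_shift q f))"

definition realize :: "complex \<Rightarrow> complex \<Rightarrow> uq_free \<Rightarrow> complex fps \<Rightarrow> complex fps" where
  "realize q \<nu> x f =
     (\<Sum>w\<in>Poly_Mapping.keys x. fps_const (Poly_Mapping.lookup x w) * foldr (realize_letter q \<nu>) (letters w) f)"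


section \<open>Little $q$-Jacobi polynomials\<close>

definition qpoch :: "complex \<Rightarrow> complex \<Rightarrow> nat \<Rightarrow> complex" where
  "qpoch a p n = (\<Prod>k<n. 1 - a * p ^ k)"

text \<open>The little $q$-Jacobi polynomial in base \<open>p\<close>.\<close>

definition little_q_jacobi :: "complex \<Rightarrow> complex \<Rightarrow> complex \<Rightarrow> nat \<Rightarrow> complex poly" where
  "little_q_jacobi p a b n =
     (\<Sum>m\<le>n. smult (qpoch (inverse p ^ n) p m * qpoch (a * b * p ^ (n + 1)) p m
               / (qpoch (p * a) p m * qpoch p p m)) ([:0, p:] ^ m))"


section \<open>Diagonalization\<close>

text \<open>A linear operator on formal power series is diagonalized by a sequence of polynomials if these
  are eigenvectors and form a basis of the space of polynomials (in particular they are nonzero, and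
  the operator preserves the polynomials).\<close>

definition diagonalized_by :: "(complex fps \<Rightarrow> complex fps) \<Rightarrow> (nat \<Rightarrow> complex poly) \<Rightarrow> bool" where
  "diagonalized_by A P \<longleftrightarrow>
     (\<forall>n. \<exists>l. A (fps_of_poly (P n)) = fps_const l * fps_of_poly (P n)) \<and>
     inj P \<and> \<not> module.dependent smult (range P) \<and> module.span smult (range P) = UNIV"


section \<open>Consistency of the definitions\<close>

lemma scal_add: "scal (a + b) = scal a + scal b"
  and scal_diff: "scal (a - b) = scal a - scal b"
  and scal_minus: "scal (- a) = - scal a"
  and scal_mult: "scal (a * b) = scal a * scal b"
  and scal_1 [simp]: "scal 1 = 1"
  and scal_0 [simp]: "scal 0 = 0"
  by (simp_all add: scal_def single_add single_diff single_uminus mult_single)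

lemma uq_free_induct [case_names single add]:
  fixes x :: uq_free
  assumes "\<And>w a. P (Poly_Mapping.single w a)" "\<And>x y. P x \<Longrightarrow> P y \<Longrightarrow> P (x + y)"
  shows "P x"
proof -
  have "P (\<Sum>w\<in>A. Poly_Mapping.single w (Poly_Mapping.lookup x w))" if "finite A" for A
    using that
  proof induction
    case empty
    show ?case using assms(1)[of 0 0] by simp
  next
    case (insert w A)
    then show ?case using assms by simp
  qed
  moreover have "x = (\<Sum>w\<in>Poly_Mapping.keys x. Poly_Mapping.single w (Poly_Mapping.lookup x w))"
    by (rule poly_mapping_eqI)
       (auto simp: lookup_sum lookup_single when_def in_keys_iff)
  ultimately show ?thesis by (metis finite_keys)
qed

lemma scal_commute: "x * scal a = scal a * x"
  by (induction x rule: uq_free_induct)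
     (simp_all add: scal_def mult_single mult.commute algebra_simps)

lemma scal_left_commute: "x * (scal a * y) = scal a * (x * y)"
  by (metis mult.assoc scal_commute)

lemma scal_minus_1: "scal (- 1) = - 1"
  by (simp add: scal_minus)

lemma uq_ideal_add: "x \<in> uq_ideal q \<Longrightarrow> y \<in> uq_ideal q \<Longrightarrow> x + y \<in> uq_ideal q"
  by (induction rule: uq_ideal.induct) (auto simp: add.assoc intro: uq_ideal.intros)

lemma uq_ideal_mult: "x \<in> uq_ideal q \<Longrightarrow> u * x * v \<in> uq_ideal q"
proof (induction rule: uq_ideal.induct)
  case zero
  show ?case by (simp add: uq_ideal.zero)
next
  case (step r s x y)
  have "u * (x * r * y + s) * v = (u * x) * r * (y * v) + u * s * v"
    by (simp add: algebra_simps)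
  with step show ?case by (simp add: uq_ideal.step)
qed

lemma uq_ideal_relator: "r \<in> uq_relators q \<Longrightarrow> r \<in> uq_ideal q"
  using uq_ideal.step[OF _ uq_ideal.zero, of r q 1 1] by simp

lemma uq_eq_refl [simp, intro]: "uq_eq q x x"
  by (simp add: uq_eq_def uq_ideal.zero)

lemma uq_eq_sym: "uq_eq q x y \<Longrightarrow> uq_eq q y x"
  using uq_ideal_mult[of "x - y" q "- 1" 1] by (simp add: uq_eq_def)

lemma uq_eq_trans [trans]: "uq_eq q x y \<Longrightarrow> uq_eq q y z \<Longrightarrow> uq_eq q x z"
  unfolding uq_eq_def by (drule (1) uq_ideal_add) simp

lemma uq_eq_add: "uq_eq q x x' \<Longrightarrow> uq_eq q y y' \<Longrightarrow> uq_eq q (x + y) (x' + y')"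
  unfolding uq_eq_def by (drule (1) uq_ideal_add) (simp add: algebra_simps)

lemma uq_eq_mult_mult: "uq_eq q x y \<Longrightarrow> uq_eq q (u * x * v) (u * y * v)"
  unfolding uq_eq_def using uq_ideal_mult[of "x - y" q u v] by (simp add: algebra_simps)

lemma uq_eq_mult: "uq_eq q x x' \<Longrightarrow> uq_eq q y y' \<Longrightarrow> uq_eq q (x * y) (x' * y')"
  using uq_eq_mult_mult[of q x x' 1 y] uq_eq_mult_mult[of q y y' x' 1]
  by (auto intro: uq_eq_trans)

lemma uq_eq_minus: "uq_eq q x x' \<Longrightarrow> uq_eq q (- x) (- x')"
  using uq_eq_mult[of q "- 1" "- 1" x x'] by simp

lemma uq_eq_diff: "uq_eq q x x' \<Longrightarrow> uq_eq q y y' \<Longrightarrow> uq_eq q (x - y) (x' - y')"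
  using uq_eq_add[of q x x' "- y" "- y'"] by (simp add: uq_eq_minus)

lemma realize_alt:
  assumes "finite A" "Poly_Mapping.keys x \<subseteq> A"
  shows "realize q \<nu> x f =
    (\<Sum>w\<in>A. fps_const (Poly_Mapping.lookup x w) * foldr (realize_letter q \<nu>) (letters w) f)"
  unfolding realize_def using assms
  by (intro sum.mono_neutral_left) (auto simp: in_keys_iff)

lemma realize_single:
  "realize q \<nu> (Poly_Mapping.single w a) f = fps_const a * foldr (realize_letter q \<nu>) (letters w) f"
  by (subst realize_alt[where A = "{w}"]) auto

lemma realize_add: "realize q \<nu> (x + y) f = realize q \<nu> x f + realize q \<nu> y f"
proof -
  let ?A = "Poly_Mapping.keys x \<union> Poly_Mapping.keys y"
  have "realize q \<nu> z f = (\<Sum>w\<in>?A. fps_const (Poly_Mapping.lookup z w) * foldr (realize_letter q \<nu>) (letters w) f)"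
    if "z \<in> {x, y, x + y}" for z
    using that Poly_Mapping.keys_add[of x y] by (intro realize_alt) auto
  then show ?thesis
    by (simp add: lookup_add sum.distrib distrib_right flip: fps_const_add)
qed

lemma realize_letter_linear:
  "realize_letter q \<nu> l (f + g) = realize_letter q \<nu> l f + realize_letter q \<nu> l g"
  "realize_letter q \<nu> l (fps_const t * f) = fps_const t * realize_letter q \<nu> l f"
  by (cases l; simp add: q_shift_def fps_compose_add_distrib fps_compose_mult_distrib
    fps_eq_iff algebra_simps fps_shift_def; fail)+

lemma realize_letters_linear:
  "foldr (realize_letter q \<nu>) w (f + g) = foldr (realize_letter q \<nu>) w f + foldr (realize_letter q \<nu>) w g"
  "foldr (realize_letter q \<nu>) w (fps_const t * f) = fps_const t * foldr (realize_letter q \<nu>) w f"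
  by (induction w) (simp_all add: realize_letter_linear)

lemma realize_linear:
  "realize q \<nu> x (f + g) = realize q \<nu> x f + realize q \<nu> x g"
  "realize q \<nu> x (fps_const t * f) = fps_const t * realize q \<nu> x f"
  by (simp_all add: realize_def realize_letters_linear sum.distrib distrib_left sum_distrib_left
      mult.left_commute)

lemma realize_mult: "realize q \<nu> (x * y) f = realize q \<nu> x (realize q \<nu> y f)"
proof (induction x rule: uq_free_induct)
  case (single u a)
  show ?case
    by (induction y rule: uq_free_induct)
       (simp_all add: realize_single realize_add mult_single plus_uq_word_def
          realize_letters_linear algebra_simps flip: fps_const_mult)
qed (simp_all add: algebra_simps realize_add)

lemma realize_scal [simp]: "realize q \<nu> (scal a) f = fps_const a * f"
  by (simp add: scal_def realize_single zero_uq_word_def)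

lemma realize_gen [simp]: "realize q \<nu> (gen l) f = realize_letter q \<nu> l f"
  by (simp add: gen_def realize_single)

lemma realize_zero [simp]: "realize q \<nu> 0 f = 0"
  and realize_one [simp]: "realize q \<nu> 1 f = f"
  using realize_scal[of q \<nu> 0 f] realize_scal[of q \<nu> 1 f] by simp_all

lemma realize_minus: "realize q \<nu> (- x) f = - realize q \<nu> x f"
  using realize_add[of q \<nu> x "- x" f] by (simp add: eq_neg_iff_add_eq_0 add.commute)

lemma realize_diff: "realize q \<nu> (x - y) f = realize q \<nu> x f - realize q \<nu> y f"
  using realize_add[of q \<nu> x "- y" f] by (simp add: realize_minus)

lemma powr_double:
  fixes q \<nu> :: complex
  shows "q powr (2 * \<nu>) = (q powr \<nu>)\<^sup>2" "q powr (- (2 * \<nu>)) = (inverse (q powr \<nu>))\<^sup>2"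
  by (simp_all only: powr_minus mult_2 powr_add power2_eq_square inverse_mult_distrib)

lemma q_square_neq_1:
  fixes q :: complex
  shows "q \<noteq> 0 \<Longrightarrow> q ^ 2 \<noteq> 1 \<Longrightarrow> q - inverse q \<noteq> 0"
  by (simp add: field_simps power2_eq_square)

lemma realize_letter_nth:
  fixes q \<nu> :: complex
  defines "u \<equiv> q powr \<nu>" and "D \<equiv> inverse (q - inverse q)"
  shows "fps_nth (realize_letter q \<nu> Kplus f) n = inverse u * q ^ n * fps_nth f n"
    and "fps_nth (realize_letter q \<nu> Kminus f) n = u * inverse q ^ n * fps_nth f n"
    and "fps_nth (realize_letter q \<nu> Splus f) n =
           (if n = 0 then 0
            else D * (u ^ 2 * inverse q ^ (n - 1) - inverse u ^ 2 * q ^ (n - 1)) * fps_nth f (n - 1))"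
    and "fps_nth (realize_letter q \<nu> Sminus f) n =
           - D * (inverse q ^ Suc n - q ^ Suc n) * fps_nth f (Suc n)"
proof -
  show "fps_nth (realize_letter q \<nu> Kplus f) n = inverse u * q ^ n * fps_nth f n"
    and "fps_nth (realize_letter q \<nu> Kminus f) n = u * inverse q ^ n * fps_nth f n"
    by (simp_all add: q_shift_def powr_minus u_def)
  show "fps_nth (realize_letter q \<nu> Sminus f) n =
           - D * (inverse q ^ Suc n - q ^ Suc n) * fps_nth f (Suc n)"
    unfolding D_def realize_letter.simps q_shift_def fps_neg_nth fps_shift_nth fps_mult_left_const_nth
      fps_sub_nth fps_nth_compose_linear Suc_eq_plus1[symmetric]
    by (simp only: left_diff_distrib right_diff_distrib mult.assoc mult_minus_left minus_diff_eq
        diff_minus_eq_add uminus_add_conv_diff)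
  show "fps_nth (realize_letter q \<nu> Splus f) n =
           (if n = 0 then 0
            else D * (u ^ 2 * inverse q ^ (n - 1) - inverse u ^ 2 * q ^ (n - 1)) * fps_nth f (n - 1))"
    unfolding D_def u_def realize_letter.simps q_shift_def powr_double fps_X_mult_nth
      fps_mult_left_const_nth fps_sub_nth fps_nth_compose_linear
    by (simp only: left_diff_distrib right_diff_distrib mult.assoc)
qed

text \<open>The realization respects the defining relations.\<close>

lemma realize_relator:
  assumes "q \<noteq> 0" "q ^ 2 \<noteq> 1" "r \<in> uq_relators q"
  shows "realize q \<nu> r f = 0"
proof -
  define u where "u = q powr \<nu>"
  have nz: "u \<noteq> 0" using assms(1) by (simp add: u_def)
  define D where "D = inverse (q - inverse q)"
  have D: "D \<noteq> 0" "q - inverse q = inverse D" using assms q_square_neq_1 by (auto simp: D_def)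
  note nth = realize_letter_nth[of q \<nu>, folded u_def D_def]
  have D1: "D * (q - inverse q) = 1" using D by simp
  have q1: "q * inverse q = 1" using assms by simp
  have "fps_nth (realize q \<nu> (S_plus * S_minus - S_minus * S_plus - scal D * (K ^ 2 - K' ^ 2)) f) n = 0" for n
  proof (cases n)
    case 0
    have "fps_nth (realize q \<nu> (S_plus * S_minus - S_minus * S_plus - scal D * (K ^ 2 - K' ^ 2)) f) n
      = - D * (u ^ 2 - inverse u ^ 2) * fps_nth f 0 * (D * (q - inverse q) - 1)"
      by (simp add: 0 realize_diff realize_mult nth power2_eq_square del: realize_letter.simps)
        (simp add: algebra_simps)
    then show ?thesis by (simp add: D1)
  next
    case (Suc k)
    define P R where "P = q ^ Suc k" and "R = inverse q ^ Suc k"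
    have PR: "q ^ k = inverse q * P" "inverse q ^ k = q * R"
      using assms(1) by (simp_all add: P_def R_def)
    have "D * (u ^ 2 * (q * R) - inverse u ^ 2 * (inverse q * P)) * (R - P)
        + D * (u ^ 2 * R - inverse u ^ 2 * P) * (q * P - inverse q * R)
      = D * (q - inverse q) * (u ^ 2 * R ^ 2 - inverse u ^ 2 * P ^ 2)"
      by (simp add: algebra_simps power2_eq_square)
    then have id: "D * (u ^ 2 * (q * R) - inverse u ^ 2 * (inverse q * P)) * (R - P)
        + D * (u ^ 2 * R - inverse u ^ 2 * P) * (q * P - inverse q * R)
        + (inverse u ^ 2 * P ^ 2 - u ^ 2 * R ^ 2) = 0"
      by (simp add: D1)
    have "fps_nth (realize q \<nu> (S_plus * S_minus - S_minus * S_plus - scal D * (K ^ 2 - K' ^ 2)) f) n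
      = - D * fps_nth f (Suc k) *
        (D * (u ^ 2 * (q * R) - inverse u ^ 2 * (inverse q * P)) * (R - P)
        + D * (u ^ 2 * R - inverse u ^ 2 * P) * (q * P - inverse q * R)
        + (inverse u ^ 2 * P ^ 2 - u ^ 2 * R ^ 2))"
      unfolding PR[symmetric]
      by (simp add: Suc realize_diff realize_mult nth power2_eq_square P_def R_def
          del: realize_letter.simps) (simp add: algebra_simps)
    then show ?thesis by (simp add: id)
  qed
  then have "realize q \<nu> (S_plus * S_minus - S_minus * S_plus - scal D * (K ^ 2 - K' ^ 2)) f = 0"
    by (simp add: fps_eq_iff)
  moreover have "realize q \<nu> (K * K' - 1) f = 0" "realize q \<nu> (K' * K - 1) f = 0"
    using assms(1) nz
    by (simp_all add: fps_eq_iff realize_diff realize_mult nth power_inverse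
        del: realize_letter.simps) (simp_all add: field_simps)
  moreover have "realize q \<nu> (K * S_plus - scal q * S_plus * K) f = 0"
  proof (rule fps_ext)
    show "fps_nth (realize q \<nu> (K * S_plus - scal q * S_plus * K) f) n = fps_nth 0 n" for n
      by (cases n) (simp_all add: realize_diff realize_mult nth del: realize_letter.simps)
  qed
  moreover have "realize q \<nu> (K * S_minus - scal (inverse q) * S_minus * K) f = 0"
    using assms(1)
    by (intro fps_ext) (simp add: realize_diff realize_mult nth del: realize_letter.simps)
  ultimately show ?thesis
    using assms(3) unfolding uq_relators_def D_def by blast
qed

lemma realize_uq_eq:
  assumes "q \<noteq> 0" "q ^ 2 \<noteq> 1" "uq_eq q x y"
  shows "realize q \<nu> x = realize q \<nu> y"
proof -
  have "realize q \<nu> z f = 0" if "z \<in> uq_ideal q" for z f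
    using that by induction
      (simp_all add: realize_add realize_mult realize_relator[OF assms(1,2)] realize_linear(2)[of q \<nu> _ 0, simplified])
  from this[of "x - y"] assms(3) show ?thesis
    by (auto simp add: uq_eq_def fun_eq_iff realize_diff)
qed

lemma realize_Casimir:
  fixes q \<nu> :: complex
  assumes "q \<noteq> 0" "q ^ 2 \<noteq> 1"
  shows "realize q \<nu> (Casimir q) f =
    fps_const ((q powr (2 * \<nu> + 1) + q powr (- (2 * \<nu>) - 1)) / (q - inverse q) ^ 2) * f"
proof (rule fps_ext)
  fix n
  define u where "u = q powr \<nu>"
  define D where "D = inverse (q - inverse q)"
  note nth = realize_letter_nth[of q \<nu>, folded u_def D_def]
  have p: "q powr (2 * \<nu> + 1) = u ^ 2 * q" "q powr (- (2 * \<nu>) - 1) = inverse u ^ 2 * inverse q"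
    using powr_double[of q \<nu>] assms(1) by (simp_all add: u_def powr_add powr_diff divide_inverse)
  have D2: "inverse ((q - inverse q) ^ 2) = D * D"
    by (simp add: D_def power2_eq_square)
  show "fps_nth (realize q \<nu> (Casimir q) f) n = fps_nth (fps_const ((q powr (2 * \<nu> + 1)
      + q powr (- (2 * \<nu>) - 1)) / (q - inverse q) ^ 2) * f) n"
  proof (cases n)
    case 0
    then show ?thesis unfolding p divide_inverse D2
      by (simp add: Casimir_def D2 realize_add realize_mult nth power2_eq_square del: realize_letter.simps)
        (simp add: algebra_simps D_def)
  next
    case (Suc k)
    define P R where "P = q ^ k" and "R = inverse q ^ k"
    have PR: "P * (R * x) = x" for x
      using assms(1) by (simp add: P_def R_def power_inverse)
    have qq: "q * (inverse q * x) = x" for x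
      using assms(1) by simp
    show ?thesis unfolding p divide_inverse D2 fps_mult_left_const_nth
      apply (simp add: Suc Casimir_def D2 realize_add realize_mult nth power2_eq_square del: realize_letter.simps)
      apply (simp add: algebra_simps D_def PR qq flip: P_def R_def)
      done
  qed
qed

lemma uq_eq_scal: "uq_eq q x y \<Longrightarrow> uq_eq q (scal a * x) (scal a * y)"
  by (intro uq_eq_mult) auto

lemma uq_relations:
  shows "uq_eq q (K * K') 1" "uq_eq q (K' * K) 1"
    and "uq_eq q (K * S_plus) (scal q * (S_plus * K))"
    and "uq_eq q (K * S_minus) (scal (inverse q) * (S_minus * K))"
    and "uq_eq q (S_minus * S_plus)
           (S_plus * S_minus - scal (inverse (q - inverse q)) * (K ^ 2 - K' ^ 2))"
proof -
  have *: "uq_eq q (S_plus * S_minus - scal (inverse (q - inverse q)) * (K ^ 2 - K' ^ 2)) (S_minus * S_plus)"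
    unfolding uq_eq_def
    using uq_ideal_relator[of "S_plus * S_minus - S_minus * S_plus - scal (inverse (q - inverse q)) * (K ^ 2 - K' ^ 2)" q]
    by (simp add: uq_relators_def algebra_simps)
  show "uq_eq q (S_minus * S_plus)
           (S_plus * S_minus - scal (inverse (q - inverse q)) * (K ^ 2 - K' ^ 2))"
    by (rule uq_eq_sym[OF *])
qed (simp_all add: uq_eq_def uq_ideal_relator uq_relators_def flip: mult.assoc)

lemma Kminus_commute:
  assumes "a \<noteq> 0" "uq_eq q (K * x) (scal a * (x * K))"
  shows "uq_eq q (K' * x) (scal (inverse a) * (x * K'))"
proof -
  have "uq_eq q (K' * (K * x) * K') (K' * (scal a * (x * K)) * K')"
    using assms(2) by (rule uq_eq_mult_mult)
  moreover have "uq_eq q (K' * (K * x) * K') (x * K')"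
    using uq_eq_mult_mult[OF uq_relations(2), of q 1 "x * K'"] by (simp add: mult.assoc)
  moreover have "uq_eq q (K' * (scal a * (x * K)) * K') (scal a * (K' * x))"
    using uq_eq_mult_mult[OF uq_relations(1), of q "scal a * K' * x" 1]
    by (simp add: mult.assoc scal_left_commute)
  ultimately have "uq_eq q (scal a * (K' * x)) (x * K')"
    by (meson uq_eq_trans uq_eq_sym)
  then have "uq_eq q (scal (inverse a) * (scal a * (K' * x))) (scal (inverse a) * (x * K'))"
    by (rule uq_eq_scal)
  then show ?thesis
    using assms(1) by (simp flip: mult.assoc scal_mult)
qed

lemma normal_order:
  assumes "uq_eq q (A * B) 1" "uq_eq q (A * x) (scal a * (x * A))"
  shows "uq_eq q (y * A * (x * B)) (scal a * (y * x))"
    and "uq_eq q (y * A * B ^ 2) (y * B)"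
    and "uq_eq q (A ^ 2 * (x * B)) (scal (a ^ 2) * (x * A))"
    and "uq_eq q (A ^ 2 * B ^ 2) 1"
proof -
  show 1: "uq_eq q (y * A * (x * B)) (scal a * (y * x))" for y
  proof -
    have "uq_eq q (y * A * (x * B)) (scal a * (y * x * (A * B)))"
      using uq_eq_mult_mult[OF assms(2), of y B] by (simp add: mult.assoc scal_left_commute)
    also have "uq_eq q \<dots> (scal a * (y * x))"
      using uq_eq_mult_mult[OF assms(1), of "scal a * (y * x)" 1] by (simp add: mult.assoc)
    finally show ?thesis .
  qed
  show 2: "uq_eq q (y * A * B ^ 2) (y * B)" for y
    using uq_eq_mult_mult[OF assms(1), of y B] by (simp add: mult.assoc power2_eq_square)
  show "uq_eq q (A ^ 2 * (x * B)) (scal (a ^ 2) * (x * A))"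
  proof -
    have "uq_eq q (A ^ 2 * (x * B)) (scal a * (A * x))"
      using 1[of A] by (simp add: power2_eq_square)
    also have "uq_eq q \<dots> (scal a * (scal a * (x * A)))"
      by (intro uq_eq_scal assms(2))
    finally show ?thesis by (simp add: power2_eq_square scal_mult mult.assoc)
  qed
  show "uq_eq q (A ^ 2 * B ^ 2) 1"
    using uq_eq_trans[OF 2[of A] assms(1)] by (simp add: power2_eq_square)
qed

lemma product_normal_order:
  assumes A: "uq_eq q (A * B) 1"
    and p: "uq_eq q (A * S_plus) (scal a * (S_plus * A))"
    and m: "uq_eq q (A * S_minus) (scal a' * (S_minus * A))"
  shows "uq_eq q
    ((scal c * S_plus * A + scal cb * S_minus * A + scal e * A ^ 2 + scal m) *
     (scal d * S_plus * B + scal db * S_minus * B + scal h * B ^ 2 + scal n))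
    (scal (c * d * a) * (S_plus * S_plus) + scal (c * db * a') * (S_plus * S_minus)
       + scal (c * h) * (S_plus * B) + scal (c * n) * (S_plus * A)
     + (scal (cb * d * a) * (S_minus * S_plus) + scal (cb * db * a') * (S_minus * S_minus)
       + scal (cb * h) * (S_minus * B) + scal (cb * n) * (S_minus * A))
     + (scal (e * d * a ^ 2) * (S_plus * A) + scal (e * db * a' ^ 2) * (S_minus * A)
       + scal (e * h) * 1 + scal (e * n) * A ^ 2)
     + (scal (m * d) * (S_plus * B) + scal (m * db) * (S_minus * B) + scal (m * h) * B ^ 2 + scal (m * n)))"
proof -
  have scal: "uq_eq q (scal (u * v) * x) (scal (u * v * w) * y)" if "uq_eq q x (scal w * y)" for u v w x y
    using uq_eq_scal[OF that, of "u * v"] by (simp add: scal_mult mult.assoc)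
  have eq: "(scal c * S_plus * A + scal cb * S_minus * A + scal e * A ^ 2 + scal m) *
     (scal d * S_plus * B + scal db * S_minus * B + scal h * B ^ 2 + scal n) =
    scal (c * d) * (S_plus * A * (S_plus * B)) + scal (c * db) * (S_plus * A * (S_minus * B))
       + scal (c * h) * (S_plus * A * B ^ 2) + scal (c * n) * (S_plus * A)
     + (scal (cb * d) * (S_minus * A * (S_plus * B)) + scal (cb * db) * (S_minus * A * (S_minus * B))
       + scal (cb * h) * (S_minus * A * B ^ 2) + scal (cb * n) * (S_minus * A))
     + (scal (e * d) * (A ^ 2 * (S_plus * B)) + scal (e * db) * (A ^ 2 * (S_minus * B))
       + scal (e * h) * (A ^ 2 * B ^ 2) + scal (e * n) * A ^ 2)
     + (scal (m * d) * (S_plus * B) + scal (m * db) * (S_minus * B) + scal (m * h) * B ^ 2 + scal (m * n))"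
    (is "_ = ?R")
    by (simp only: distrib_left distrib_right power2_eq_square mult.assoc scal_mult
        scal_left_commute[of A] scal_left_commute[of B] scal_left_commute[of "gen _"]
        scal_commute[of A] scal_commute[of B] scal_commute[of "gen _"] add.assoc add.commute add.left_commute)
  have "uq_eq q ?R
    (scal (c * d * a) * (S_plus * S_plus) + scal (c * db * a') * (S_plus * S_minus)
       + scal (c * h) * (S_plus * B) + scal (c * n) * (S_plus * A)
     + (scal (cb * d * a) * (S_minus * S_plus) + scal (cb * db * a') * (S_minus * S_minus)
       + scal (cb * h) * (S_minus * B) + scal (cb * n) * (S_minus * A))
     + (scal (e * d * a ^ 2) * (S_plus * A) + scal (e * db * a' ^ 2) * (S_minus * A)
       + scal (e * h) * 1 + scal (e * n) * A ^ 2)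
     + (scal (m * d) * (S_plus * B) + scal (m * db) * (S_minus * B) + scal (m * h) * B ^ 2 + scal (m * n)))"
    by (intro uq_eq_add; rule uq_eq_refl scal[OF normal_order(1)[OF A p]] scal[OF normal_order(1)[OF A m]]
        scal[OF normal_order(3)[OF A p]] scal[OF normal_order(3)[OF A m]]
        uq_eq_scal[OF normal_order(2)[OF A p]] uq_eq_scal[OF normal_order(4)[OF A p]])
  then show ?thesis unfolding eq .
qed

text \<open>The expansion of $G_1$ in $U_q(sl(2))$.\<close>

lemma G1_expansion:
  assumes "q \<noteq> 0" "q ^ 2 \<noteq> 1"
  shows "uq_eq q (G1 q c cb e m)
    (scal (g1 q c cb e m) * S_minus ^ 2
     + scal (g2 q c cb e m) * S_minus * K' + scal (g3 q c cb e m) * S_minus * K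
     + scal (g2' q c cb e m) * S_plus * K' + scal (g3' q c cb e m) * S_plus * K
     + scal (g4 q c cb e m) * K ^ 2 + scal (g5 q c cb e m) * K' ^ 2 + g6 q c cb e m)"
proof -
  define D where "D = inverse (q - inverse q)"
  have D: "D * (q - inverse q) = 1" using assms q_square_neq_1 by (auto simp: D_def)
  note K = uq_relations[of q]
  note K' = Kminus_commute[OF assms(1) K(3)] Kminus_commute[OF _ K(4), simplified, OF assms(1)]
  note P = product_normal_order[OF K(2) K', of "c 1" "cb 1" "e 1" "m 1" "c 0" "cb 0" "e 0" "m 0"]
  note Q = product_normal_order[OF K(1,3,4), of "c 0" "cb 0" "e 0" "m 0" "c 1" "cb 1" "e 1" "m 1"]
  define Z where "Z a1 a2 a3 a4 a5 a6 a7 a8 a9 b1 =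
      scal a1 * (S_plus * S_plus) + scal a2 * (S_plus * S_minus) + scal a3 * (S_minus * S_minus)
    + scal a4 * (S_plus * K) + scal a5 * (S_plus * K') + scal a6 * (S_minus * K) + scal a7 * (S_minus * K')
    + scal a8 * K ^ 2 + scal a9 * K' ^ 2 + scal b1 * 1"
    for a1 a2 a3 a4 a5 a6 a7 a8 a9 b1
  have shift: "Z a1 a2 a3 a4 a5 a6 a7 a8 a9 b1 + scal t * (S_plus * S_minus - scal D * (K ^ 2 - K' ^ 2))
      = Z a1 (a2 + t) a3 a4 a5 a6 a7 (a8 - t * D) (a9 + t * D) b1" for a1 a2 a3 a4 a5 a6 a7 a8 a9 b1 t
    by (simp add: Z_def scal_add scal_diff scal_mult distrib_left distrib_right left_diff_distrib
        right_diff_distrib mult.assoc)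
  define r where "r = inverse q"
  define t where "t = q * (cb 1 * c 0 * r) - r * (cb 0 * c 1 * q)"
  have r: "q * r = 1" using assms by (simp add: r_def)
  let ?a1 = "q * (c 1 * c 0 * r) - r * (c 0 * c 1 * q)"
  let ?a2 = "q * (c 1 * cb 0 * q) - r * (c 0 * cb 1 * r)"
  let ?a3 = "q * (cb 1 * cb 0 * q) - r * (cb 0 * cb 1 * r)"
  let ?a4 = "q * (c 1 * e 0) + q * (m 1 * c 0) - r * (c 0 * m 1) - r * (e 0 * c 1 * q ^ 2)"
  let ?a5 = "q * (c 1 * m 0) + q * (e 1 * c 0 * r ^ 2) - r * (c 0 * e 1) - r * (m 0 * c 1)"
  let ?a6 = "q * (cb 1 * e 0) + q * (m 1 * cb 0) - r * (cb 0 * m 1) - r * (e 0 * cb 1 * r ^ 2)"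
  let ?a7 = "q * (cb 1 * m 0) + q * (e 1 * cb 0 * q ^ 2) - r * (cb 0 * e 1) - r * (m 0 * cb 1)"
  let ?a8 = "q * (m 1 * e 0) - r * (e 0 * m 1)"
  let ?a9 = "q * (e 1 * m 0) - r * (m 0 * e 1)"
  let ?b1 = "q * (e 1 * e 0) + q * (m 1 * m 0) - r * (e 0 * e 1) - r * (m 0 * m 1)"
  have s1: "G1 q c cb e m = scal q * (W1 c cb e m * W0 c cb e m) - scal r * (W0 c cb e m * W1 c cb e m)"
    by (simp add: G1_def mult.assoc r_def)
  have s2: "uq_eq q (scal q * (W1 c cb e m * W0 c cb e m) - scal r * (W0 c cb e m * W1 c cb e m))
    (Z ?a1 ?a2 ?a3 ?a4 ?a5 ?a6 ?a7 ?a8 ?a9 ?b1 + scal t * (S_minus * S_plus))"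
  proof -
    have eq: "scal q * X - scal r * Y = Z ?a1 ?a2 ?a3 ?a4 ?a5 ?a6 ?a7 ?a8 ?a9 ?b1 + scal t * (S_minus * S_plus)"
      if "X = (scal (c 1 * c 0 * r) * (S_plus * S_plus) + scal (c 1 * cb 0 * q) * (S_plus * S_minus)
       + scal (c 1 * e 0) * (S_plus * K) + scal (c 1 * m 0) * (S_plus * K')
     + (scal (cb 1 * c 0 * r) * (S_minus * S_plus) + scal (cb 1 * cb 0 * q) * (S_minus * S_minus)
       + scal (cb 1 * e 0) * (S_minus * K) + scal (cb 1 * m 0) * (S_minus * K'))
     + (scal (e 1 * c 0 * r ^ 2) * (S_plus * K') + scal (e 1 * cb 0 * q ^ 2) * (S_minus * K')
       + scal (e 1 * e 0) * 1 + scal (e 1 * m 0) * K' ^ 2)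
     + (scal (m 1 * c 0) * (S_plus * K) + scal (m 1 * cb 0) * (S_minus * K) + scal (m 1 * e 0) * K ^ 2
       + scal (m 1 * m 0)))"
       "Y = (scal (c 0 * c 1 * q) * (S_plus * S_plus) + scal (c 0 * cb 1 * r) * (S_plus * S_minus)
       + scal (c 0 * e 1) * (S_plus * K') + scal (c 0 * m 1) * (S_plus * K)
     + (scal (cb 0 * c 1 * q) * (S_minus * S_plus) + scal (cb 0 * cb 1 * r) * (S_minus * S_minus)
       + scal (cb 0 * e 1) * (S_minus * K') + scal (cb 0 * m 1) * (S_minus * K))
     + (scal (e 0 * c 1 * q ^ 2) * (S_plus * K) + scal (e 0 * cb 1 * r ^ 2) * (S_minus * K)
       + scal (e 0 * e 1) * 1 + scal (e 0 * m 1) * K ^ 2)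
     + (scal (m 0 * c 1) * (S_plus * K') + scal (m 0 * cb 1) * (S_minus * K') + scal (m 0 * e 1) * K' ^ 2
       + scal (m 0 * m 1)))"
      for X Y
      unfolding that Z_def t_def scal_add scal_diff scal_mult distrib_left left_diff_distrib distrib_right
        right_diff_distrib mult.assoc mult_1_right
      by simp
    show ?thesis
      using uq_eq_diff[OF uq_eq_scal[OF P] uq_eq_scal[OF Q], of q r]
      by (subst (asm) eq) (simp_all add: r_def W0_def W1_def)
  qed
  have s3: "uq_eq q (Z ?a1 ?a2 ?a3 ?a4 ?a5 ?a6 ?a7 ?a8 ?a9 ?b1 + scal t * (S_minus * S_plus))
      (Z ?a1 (?a2 + t) ?a3 ?a4 ?a5 ?a6 ?a7 (?a8 - t * D) (?a9 + t * D) ?b1)"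
    unfolding shift[symmetric] by (rule uq_eq_add[OF uq_eq_refl uq_eq_scal[OF K(5)[folded D_def]]])
  have s4: "Z ?a1 (?a2 + t) ?a3 ?a4 ?a5 ?a6 ?a7 (?a8 - t * D) (?a9 + t * D) ?b1 =
    (scal (g1 q c cb e m) * S_minus ^ 2
     + scal (g2 q c cb e m) * S_minus * K' + scal (g3 q c cb e m) * S_minus * K
     + scal (g2' q c cb e m) * S_plus * K' + scal (g3' q c cb e m) * S_plus * K
     + scal (g4 q c cb e m) * K ^ 2 + scal (g5 q c cb e m) * K' ^ 2 + g6 q c cb e m)"
  proof -
    define w where "w = (c 1 * cb 0 * q + c 0 * cb 1 * r) * (q - r)"
    have D': "D * (q - r) = 1" using D by (simp add: r_def)
    have "D ^ 2 * (q - r) = D"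
      using D' by (simp add: power2_eq_square mult.assoc)
    then have wD: "w * (D ^ 2 * x) = (c 1 * cb 0 * q + c 0 * cb 1 * r) * D * x" for x
      unfolding w_def by (metis mult.assoc mult.commute)
    have a1: "?a1 = 0" by simp
    have a2: "?a2 + t = w" by (simp add: t_def w_def algebra_simps)
    have a3: "?a3 = g1 q c cb e m"
      by (simp add: g1_def algebra_simps power2_eq_square flip: r_def)
    have a4: "?a4 = g3' q c cb e m"
      unfolding g3'_def r_def[symmetric] using r by algebra
    have a5: "?a5 = g2' q c cb e m"
      unfolding g2'_def r_def[symmetric] using r by algebra
    have a6: "?a6 = g3 q c cb e m"
      unfolding g3_def r_def[symmetric] using r by algebra
    have a7: "?a7 = g2 q c cb e m"
      unfolding g2_def r_def[symmetric] using r by algebra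
    have a8: "?a8 - t * D = g4 q c cb e m + w * (D ^ 2 * r)"
      unfolding g4_def r_def[symmetric] t_def wD divide_inverse D_def[folded r_def, symmetric]
      by (simp add: algebra_simps)
    have a9: "?a9 + t * D = g5 q c cb e m + w * (D ^ 2 * q)"
      unfolding g5_def r_def[symmetric] t_def wD divide_inverse D_def[folded r_def, symmetric]
      by (simp add: algebra_simps)
    have b1: "?b1 = (e 0 * e 1 + m 0 * m 1) * (q - r)"
      by (simp add: algebra_simps)
    note a = a1 a2 a3 a4 a5 a6 a7 a8 a9 b1
    have "g6 q c cb e m = scal w * (S_plus * S_minus) + scal (w * (D ^ 2 * r)) * K ^ 2
        + scal (w * (D ^ 2 * q)) * K' ^ 2 + scal ((e 0 * e 1 + m 0 * m 1) * (q - r))"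
      by (simp add: g6_def Casimir_def w_def r_def D_def scal_mult distrib_left mult.assoc power_inverse)
    then show ?thesis
      unfolding a Z_def by (simp add: scal_add distrib_right mult.assoc power2_eq_square)
  qed
  show ?thesis
    using uq_eq_trans[OF s2 s3] unfolding s1 s4 .
qed

text \<open>The choice of scalars by which the reduced operator is obtained.  For it $g_3 = 0$ forces
  $g_4 = 0$ as soon as $g_5 \neq 0$.\<close>

lemma reduced_choice:
  assumes "c 0 = 0" "cb 1 = 0" "m 0 = 0"
  shows "g1 q c cb e m = 0" "g2' q c cb e m = 0" "g3' q c cb e m = 0"
    and "g5 q c cb e m \<noteq> 0 \<Longrightarrow> g3 q c cb e m = 0 \<Longrightarrow> g4 q c cb e m = 0"
  using assms by (auto simp: g1_def g2'_def g3'_def g3_def g4_def g5_def)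

end

theory Submission
  imports Defs
begin

text \<open>
  On coefficients the reduced operator is bidiagonal, $(\tilde G_1 f)_m = L_m f_m + M_m f_{m+1}$ with
  $L_m = g_4 u^{-2} q^{2m} + g_5 u^2 q^{-2m} + t$ and $u = q^\nu$, so that $f$ is an eigenvector with
  eigenvalue $L_n$ iff $M_m f_{m+1} = (L_n - L_m) f_m$.  The factorization of $M_m$ has the root
  parameter $a$, that of $L_n - L_m$ the parameter $a b$, and the remaining ratio of constants is the
  rescaling $\kappa$ of the variable; this recurrence is the one of the coefficients of the little
  $q$-Jacobi polynomial.  The conditions on $a$ and $a b$ make the $n$-th eigenvector of exact
  degree $n$.
\<close>

section \<open>Polynomial families with one member in each degree\<close>

lemma vector_space_poly: "vector_space (smult :: 'a::field \<Rightarrow> 'a poly \<Rightarrow> 'a poly)"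
  by unfold_locales (simp_all add: smult_add_right smult_add_left)

text \<open>Independent because no member lies in the span of the members of lower degree; spanning
  by cancelling leading terms. Since \<open>degree 0 = 0\<close>, the degree condition alone does
  not exclude \<open>P 0 = 0\<close>.\<close>

lemma triangular_basis:
  fixes P :: "nat \<Rightarrow> 'a::field poly"
  assumes deg: "\<And>n. degree (P n) = n" and nz: "P 0 \<noteq> 0"
  shows "inj P" "\<not> module.dependent smult (range P)" "module.span smult (range P) = UNIV"
proof -
  interpret vector_space "smult :: 'a \<Rightarrow> 'a poly \<Rightarrow> 'a poly"
    by (rule vector_space_poly)
  have P: "P n \<noteq> 0" for n
    using nz deg[of n] by (cases n) auto
  have lead: "coeff (P n) n \<noteq> 0" for n
    using P[of n] deg[of n] by (metis leading_coeff_0_iff)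
  show inj: "inj P"
    using deg by (metis injI)
  \<comment> \<open>The disjunct \<open>p = 0\<close> covers the zero polynomial, whose degree 0 is
    not below \<open>n = 0\<close>.\<close>
  have below: "p = 0 \<or> degree p < n" if "p \<in> span (P ` {..<n})" for p n
    using that
  proof (induction rule: span_induct_alt)
    case base
    then show ?case by simp
  next
    case (step c x y)
    then have "x = 0 \<or> degree x < n" by (auto simp: deg)
    then have "smult c x = 0 \<or> degree (smult c x) < n"
      by (auto intro: le_less_trans[OF degree_smult_le])
    with step.IH show ?case
      by (cases "smult c x = 0"; cases "y = 0") (auto intro: degree_add_less)
  qed
  have "independent (P ` {..<n})" for n
  proof (induction n)
    case (Suc n)
    have "P n \<notin> span (P ` {..<n})"
      using below[of "P n" n] P[of n] deg[of n] by auto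
    with Suc show ?case
      by (simp add: lessThan_Suc independent_insertI)
  qed (simp add: independent_empty)
  \<comment> \<open>The whole family is the union of a chain of independent initial
    segments.\<close>
  moreover have "range P = \<Union> (range (\<lambda>n. P ` {..<n}))"
    by auto
  moreover have "P ` {..<m} \<subseteq> P ` {..<n} \<or> P ` {..<n} \<subseteq> P ` {..<m}" for m n
    by (cases "m \<le> n") auto
  ultimately show "independent (range P)"
    by (smt (verit) independent_Union_directed rangeE)
  have "p \<in> span (range P)" for p
  proof (induction "degree p" arbitrary: p rule: less_induct)
    case less
    define n where "n = degree p"
    \<comment> \<open>Subtracting the multiple of \<open>P n\<close> with the same leading term
      leaves a polynomial that is zero or of lower degree.\<close>
    define r where "r = p - smult (lead_coeff p / lead_coeff (P n)) (P n)"
    have r: "coeff r i = 0" if "i \<ge> n" for i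
    proof (cases "i = n")
      case True
      then show ?thesis using lead[of n] deg[of n] by (simp add: r_def n_def)
    next
      case False
      with that show ?thesis by (simp add: r_def n_def coeff_eq_0 deg)
    qed
    have "r \<in> span (range P)"
    proof (cases "r = 0")
      case False
      then have "degree r < n" using r leading_coeff_0_iff not_le by blast
      then show ?thesis using less by (simp add: n_def)
    qed (simp add: span_zero)
    then have "r + smult (lead_coeff p / lead_coeff (P n)) (P n) \<in> span (range P)"
      by (intro span_add span_scale span_base[OF rangeI])
    then show ?case by (simp add: r_def)
  qed
  then show "span (range P) = UNIV" by auto
qed

section \<open>Coefficients of the little q-Jacobi polynomials\<close>

lemma coeff_little_q_jacobi:
  "coeff (little_q_jacobi p a b n) m =
    (if m \<le> n then qpoch (inverse p ^ n) p m * qpoch (a * b * p ^ (n + 1)) p m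
       / (qpoch (p * a) p m * qpoch p p m) * p ^ m else 0)"
proof -
  have "[:0, p:] ^ k = monom (p ^ k) k" for k
    by (metis monom_0 monom_Suc monom_power One_nat_def mult_1 pCons_0_0)
  then show ?thesis
    by (simp add: little_q_jacobi_def coeff_sum if_distrib[of "(*) _"] cong: if_cong)
qed

lemma qpoch_Suc: "qpoch a p (Suc m) = qpoch a p m * (1 - a * p ^ m)"
  by (simp add: qpoch_def)

lemma qpoch_eq_0_iff: "qpoch a p n = 0 \<longleftrightarrow> (\<exists>k<n. a * p ^ k = 1)"
  by (auto simp: qpoch_def)

text \<open>The ratio of consecutive hypergeometric terms, cross-multiplied so that it also holds at
  and beyond the top degree.\<close>

lemma coeff_little_q_jacobi_Suc:
  assumes p: "p \<noteq> 0" "\<And>k. k > 0 \<Longrightarrow> p ^ k \<noteq> 1" and a: "\<And>k. k > 0 \<Longrightarrow> a * p ^ k \<noteq> 1"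
  shows "(1 - a * p ^ Suc m) * (1 - p ^ Suc m) * coeff (little_q_jacobi p a b n) (Suc m) =
    p * (1 - inverse p ^ n * p ^ m) * (1 - a * b * p ^ (n + 1) * p ^ m) * coeff (little_q_jacobi p a b n) m"
proof -
  have nz: "1 - a * p ^ Suc m \<noteq> 0" "1 - p ^ Suc m \<noteq> 0"
    using p(2)[of "Suc m"] a[of "Suc m"] by (metis eq_iff_diff_eq_0 zero_less_Suc)+
  have shift: "qpoch (p * a) p (Suc m) = qpoch (p * a) p m * (1 - a * p ^ Suc m)"
     "qpoch p p (Suc m) = qpoch p p m * (1 - p ^ Suc m)"
    by (simp_all add: qpoch_Suc mult_ac)
  show ?thesis
  proof (cases "Suc m \<le> n")
    case True
    then show ?thesis
      using nz unfolding coeff_little_q_jacobi shift qpoch_Suc[of "_ ^ _"] qpoch_Suc[of "a * b * _"]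
      by (simp del: power_Suc) (simp add: field_simps)
  next
    \<comment> \<open>At \<open>m = n\<close> the factor \<open>1 - inverse p ^ n * p ^ n\<close>
      vanishes; for larger \<open>m\<close> both coefficients are zero.\<close>
    case False
    have "inverse p ^ n * p ^ n = 1"
      using p(1) by (simp flip: power_mult_distrib)
    with False show ?thesis
      by (cases "m = n") (auto simp: coeff_little_q_jacobi)
  qed
qed

text \<open>No factor of the top coefficient vanishes. The factors with \<open>a * b\<close> carry
  the exponents \<open>n + 1 + k\<close> for \<open>k < n\<close>, which are at least 2. The
  denominators matter as well, since division by zero would give 0.\<close>

lemma degree_little_q_jacobi:
  assumes p: "p \<noteq> 0" "\<And>k. k > 0 \<Longrightarrow> p ^ k \<noteq> 1" and a: "\<And>k. k > 0 \<Longrightarrow> a * p ^ k \<noteq> 1"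
    and ab: "\<And>k. k \<ge> 2 \<Longrightarrow> a * b * p ^ k \<noteq> 1"
  shows "coeff (little_q_jacobi p a b n) n \<noteq> 0" "degree (little_q_jacobi p a b n) = n"
proof -
  have "inverse p ^ n * p ^ k \<noteq> 1" if "k < n" for k
  proof
    assume "inverse p ^ n * p ^ k = 1"
    moreover have "p ^ n = p ^ (n - k) * p ^ k"
      using that by (simp flip: power_add)
    ultimately have "p ^ (n - k) = 1"
      using p(1) by (simp add: power_inverse field_simps)
    with p(2)[of "n - k"] that show False by simp
  qed
  moreover have "a * b * p ^ (n + 1) * p ^ k \<noteq> 1" if "k < n" for k
    using ab[of "n + 1 + k"] that by (simp add: power_add mult_ac)
  moreover have "p * a * p ^ k \<noteq> 1" "p * p ^ k \<noteq> 1" for k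
    using a[of "Suc k"] p(2)[of "Suc k"] by (simp_all add: mult_ac)
  ultimately show nz: "coeff (little_q_jacobi p a b n) n \<noteq> 0"
    using p(1) by (auto simp: coeff_little_q_jacobi qpoch_eq_0_iff)
  show "degree (little_q_jacobi p a b n) = n"
    by (rule antisym[OF degree_le le_degree[OF nz]]) (simp add: coeff_little_q_jacobi)
qed

section \<open>The reduced operator on coefficients\<close>

text \<open>The terms in \<open>K ^ 2\<close> and \<open>K' ^ 2\<close> are diagonal, and those with
  \<open>S_minus\<close> read the next coefficient. The value of \<open>t\<close> is left open
  because it only translates the spectrum.\<close>

lemma realize_G1_reduced_nth:
  fixes q \<nu> :: complex
  assumes q: "q \<noteq> 0" "q ^ 2 \<noteq> 1"
    and reduced: "g1 q c cb e m = 0" "g2' q c cb e m = 0" "g3' q c cb e m = 0"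
  defines "u \<equiv> q powr \<nu>"
  obtains t where "\<And>f n. fps_nth (realize q \<nu> (G1 q c cb e m) f) n =
    (g4 q c cb e m * inverse u ^ 2 * (q ^ 2) ^ n + g5 q c cb e m * u ^ 2 * inverse (q ^ 2) ^ n + t) * fps_nth f n
    + inverse (q - inverse q) * (1 - inverse (q ^ 2) ^ Suc n) *
      (g2 q c cb e m * u + g3 q c cb e m * inverse u * (q ^ 2) ^ Suc n) * fps_nth f (Suc n)"
proof -
  define D where "D = inverse (q - inverse q)"
  note nth = realize_letter_nth[of q \<nu>, folded u_def D_def]
  \<comment> \<open>\<open>g6\<close> is a combination of the Casimir element and 1, so it acts as a
    scalar.\<close>
  obtain t where t: "\<And>f. realize q \<nu> (g6 q c cb e m) f = fps_const t * f"
  proof -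
    obtain z where z: "\<And>f. realize q \<nu> (Casimir q) f = fps_const z * f"
      using realize_Casimir[OF q] by blast
    define x y where "x = (c 1 * cb 0 * q + c 0 * cb 1 * inverse q) * (q - inverse q)"
      and "y = (e 0 * e 1 + m 0 * m 1) * (q - inverse q)"
    have "realize q \<nu> (g6 q c cb e m) f = fps_const (x * z + y) * f" for f
      unfolding g6_def x_def[symmetric] y_def[symmetric] realize_add realize_mult realize_scal z
      by (simp add: distrib_right mult.assoc flip: fps_const_add fps_const_mult)
    then show thesis by (rule that)
  qed
  show thesis
  proof
    fix f n
    define R where "R = inverse q"
    have Rq: "R * q = 1" using q by (simp add: R_def)
    define A B where "A = q ^ n" and "B = R ^ n"
    have AB: "A * B = 1" "(q ^ 2) ^ n = A ^ 2" "inverse (q ^ 2) ^ n = B ^ 2"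
      using q(1) by (simp_all add: A_def B_def R_def power_inverse mult.commute[of n] flip: power_mult)
    have "realize q \<nu> (G1 q c cb e m) f =
       realize q \<nu> (scal (g2 q c cb e m) * S_minus * K' + scal (g3 q c cb e m) * S_minus * K
         + scal (g4 q c cb e m) * K ^ 2 + scal (g5 q c cb e m) * K' ^ 2 + g6 q c cb e m) f"
      using realize_uq_eq[OF q G1_expansion[OF q, of c cb e m], of \<nu>] reduced by simp
    then have "fps_nth (realize q \<nu> (G1 q c cb e m) f) n =
      (g4 q c cb e m * (inverse u * A * (inverse u * A)) + g5 q c cb e m * (u * B * (u * B)) + t) * fps_nth f n
      + D * ((q * A - R * B) * (g2 q c cb e m * (u * (R * B)) + g3 q c cb e m * (inverse u * (q * A)))) * fps_nth f (Suc n)"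
      by (simp add: realize_add realize_mult nth t power2_eq_square A_def B_def R_def del: realize_letter.simps)
        (simp add: algebra_simps)
    \<comment> \<open>Moving the factor \<open>q * A\<close>, that is \<open>q ^ Suc n\<close>, from
      the first bracket to the second leaves only powers of \<open>q ^ 2\<close>.\<close>
    also have "(q * A - R * B) * (g2 q c cb e m * (u * (R * B)) + g3 q c cb e m * (inverse u * (q * A)))
      = (1 - (R ^ 2) * B ^ 2) * (g2 q c cb e m * u + g3 q c cb e m * inverse u * (q ^ 2 * A ^ 2))"
      using Rq AB(1) by algebra
    finally show "fps_nth (realize q \<nu> (G1 q c cb e m) f) n =
    (g4 q c cb e m * inverse u ^ 2 * (q ^ 2) ^ n + g5 q c cb e m * u ^ 2 * inverse (q ^ 2) ^ n + t) * fps_nth f n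
    + inverse (q - inverse q) * (1 - inverse (q ^ 2) ^ Suc n) *
      (g2 q c cb e m * u + g3 q c cb e m * inverse u * (q ^ 2) ^ Suc n) * fps_nth f (Suc n)"
      unfolding power_Suc AB by (simp add: D_def R_def power2_eq_square mult_ac)
  qed
qed

section \<open>Eigenvectors and diagonalization\<close>

text \<open>With p = q^2, L_n - L_m = g5 u^2 (p^(-n) - p^(-m)) (1 - a b p^(n+m+1)), so
  \<open>simple_spectrum\<close> keeps the L_n distinct: n + m + 1 is at least 2 when n \<noteq> m.
  Likewise \<open>denominators\<close> keeps every M_m nonzero. If g3 = 0 then a = 0, and the
  relation between g4 and a b forces g4 = 0. The second half is the case \<kappa> = 1.\<close>

theorem proposition3p1:
  fixes q \<nu> a b \<kappa> :: complex and c cb e m :: "nat \<Rightarrow> complex"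
  assumes q_nonzero: "q \<noteq> 0"
    and q_not_root_of_unity: "\<And>n::nat. n > 0 \<Longrightarrow> q ^ n \<noteq> 1"
    and nu: "2 * \<nu> \<notin> \<nat>"
    and reduced: "g1 q c cb e m = 0" "g2' q c cb e m = 0" "g3' q c cb e m = 0"
    and nondegenerate: "g2 q c cb e m \<noteq> 0" "g5 q c cb e m \<noteq> 0"
      "g3 q c cb e m = 0 \<Longrightarrow> g4 q c cb e m = 0"
    and a: "a = - (g3 q c cb e m / g2 q c cb e m) * q powr (- (2 * \<nu>))"
    and b: "b = - (g2 q c cb e m / g5 q c cb e m) * (g4 q c cb e m / g3 q c cb e m) * q powr (- (2 * \<nu>) - 2)"
    and \<kappa>: "\<kappa> = (g5 q c cb e m / g2 q c cb e m) * (q - inverse q) * q powr \<nu>"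
    and denominators: "\<And>k::nat. k \<ge> 1 \<Longrightarrow> a * q ^ (2 * k) \<noteq> 1"
    and simple_spectrum: "\<And>k::nat. k \<ge> 2 \<Longrightarrow> a * b * q ^ (2 * k) \<noteq> 1"
  shows "diagonalized_by (realize q \<nu> (G1 q c cb e m))
      (\<lambda>n. pcompose (little_q_jacobi (q ^ 2) a b n) [:0, \<kappa>:]) \<and>
    (g2 q c cb e m / g5 q c cb e m = (q - inverse q) * q powr \<nu> \<longrightarrow>
      diagonalized_by (realize q \<nu> (G1 q c cb e m))
        (little_q_jacobi (q ^ 2)
          (- (g3 q c cb e m / g5 q c cb e m) * (q powr (- (3 * \<nu>)) / (q - inverse q)))
          (- (g4 q c cb e m / g3 q c cb e m) * (q - inverse q) * q powr (- \<nu> - 2))))"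
proof -
  define p where "p = q ^ 2"
  define u where "u = q powr \<nu>"
  define U where "U = inverse u"
  define D where "D = inverse (q - inverse q)"
  define \<gamma>2 \<gamma>3 \<gamma>4 \<gamma>5 where "\<gamma>2 = g2 q c cb e m" and "\<gamma>3 = g3 q c cb e m"
    and "\<gamma>4 = g4 q c cb e m" and "\<gamma>5 = g5 q c cb e m"
  note \<gamma> = \<gamma>2_def \<gamma>3_def \<gamma>4_def \<gamma>5_def
  have q2: "q ^ 2 \<noteq> 1" using q_not_root_of_unity[of 2] by simp
  have p: "p \<noteq> 0" "\<And>k. k > 0 \<Longrightarrow> p ^ k \<noteq> 1"
    using q_nonzero q_not_root_of_unity by (simp_all add: p_def flip: power_mult)
  have a1: "\<And>k. k > 0 \<Longrightarrow> a * p ^ k \<noteq> 1" and ab2: "\<And>k. k \<ge> 2 \<Longrightarrow> a * b * p ^ k \<noteq> 1"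
    using denominators simple_spectrum by (simp_all add: p_def flip: power_mult)
  have u: "u \<noteq> 0" "U \<noteq> 0" "u * U = 1" using q_nonzero by (simp_all add: u_def U_def)
  have D: "D \<noteq> 0" "D * (q - inverse q) = 1"
    using q_square_neq_1[OF q_nonzero q2] by (simp_all add: D_def)
  have nz: "\<gamma>2 \<noteq> 0" "\<gamma>5 \<noteq> 0" using nondegenerate by (simp_all add: \<gamma>)
  have qU: "q powr (- (2 * \<nu>)) = U ^ 2" "q powr (- (2 * \<nu>) - 2) = U ^ 2 * inverse p"
    "q powr (- (3 * \<nu>)) = U ^ 3" "q powr (- \<nu> - 2) = U * inverse p"
  proof -
    have q2: "q powr 2 = p"
      using powr_nat'[of q 2] q_nonzero by (simp add: p_def)
    have \<nu>3: "3 * \<nu> = \<nu> + \<nu> + \<nu>" by simp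
    show "q powr (- (2 * \<nu>)) = U ^ 2" "q powr (- (2 * \<nu>) - 2) = U ^ 2 * inverse p"
      "q powr (- \<nu> - 2) = U * inverse p"
      by (simp_all only: powr_diff powr_double q2 divide_inverse powr_minus U_def u_def power_inverse)
    show "q powr (- (3 * \<nu>)) = U ^ 3"
      by (simp only: \<nu>3 powr_minus powr_add U_def u_def power3_eq_cube inverse_mult_distrib)
  qed
  \<comment> \<open>This turns the last bracket of M_m into
    \<open>\<gamma>2 * u * (1 - a * p ^ Suc m)\<close>.\<close>
  have ga: "\<gamma>3 * U = - a * \<gamma>2 * u"
    using nz u(1) unfolding a qU by (simp add: \<gamma> U_def power2_eq_square)
  \<comment> \<open>This is the relation that factors L_n - L_m. For \<open>\<gamma>3 = 0\<close>
    the quotient in \<open>b\<close> is a division by zero, but there both sides vanish.\<close>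
  have gb: "\<gamma>4 * U ^ 2 = \<gamma>5 * u ^ 2 * (a * b * p)"
  proof (cases "\<gamma>3 = 0")
    case True
    then show ?thesis using nondegenerate(3) by (simp add: \<gamma> a)
  next
    case False
    then have "a * b * p = \<gamma>4 / \<gamma>5 * U ^ 4"
      using nz p(1) unfolding a b qU \<gamma>[symmetric] by (simp add: field_simps)
    then show ?thesis using nz u by (simp add: U_def field_simps)
  qed
  have D\<kappa>: "D * \<gamma>2 * \<kappa> = \<gamma>5 * u"
  proof -
    have "D * \<gamma>2 * \<kappa> = D * (q - inverse q) * (\<gamma>2 * (\<gamma>5 / \<gamma>2)) * u"
      unfolding \<kappa> \<gamma>[symmetric] u_def[symmetric] by (simp only: mult_ac)
    then show ?thesis using nz D(2) by simp
  qed
  \<comment> \<open>Rescaling the variable by a nonzero factor preserves degrees.\<close>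
  have \<kappa>0: "\<kappa> \<noteq> 0" using D\<kappa> nz u by auto
  define P where "P n = pcompose (little_q_jacobi p a b n) [:0, \<kappa>:]" for n
  have degree_P: "degree (P n) = n" for n
    using degree_little_q_jacobi(2)[OF p a1 ab2] \<kappa>0 by (simp add: P_def degree_pcompose)
  have "coeff (P 0) 0 \<noteq> 0"
    using degree_little_q_jacobi(1)[OF p a1 ab2, of 0] by (simp add: P_def poly_0_coeff_0)
  then have P0: "P 0 \<noteq> 0" by auto
  obtain t where t: "\<And>f n. fps_nth (realize q \<nu> (G1 q c cb e m) f) n =
    (\<gamma>4 * U ^ 2 * p ^ n + \<gamma>5 * u ^ 2 * inverse p ^ n + t) * fps_nth f n
    + D * (1 - inverse p ^ Suc n) * (\<gamma>2 * u + \<gamma>3 * U * p ^ Suc n) * fps_nth f (Suc n)"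
    using realize_G1_reduced_nth[OF q_nonzero q2 reduced, of \<nu>,
      folded \<gamma> p_def u_def, folded U_def D_def] by blast
  have "realize q \<nu> (G1 q c cb e m) (fps_of_poly (P n)) =
    fps_const (\<gamma>4 * U ^ 2 * p ^ n + \<gamma>5 * u ^ 2 * inverse p ^ n + t) * fps_of_poly (P n)" for n
  proof (rule fps_ext)
    fix k
    define X X' Y Y' where "X = p ^ k" and "X' = inverse p ^ k" and "Y = p ^ n" and "Y' = inverse p ^ n"
    have XY: "X * X' = 1" "Y * Y' = 1" "p * inverse p = 1"
      using p(1) by (simp_all add: X_def X'_def Y_def Y'_def flip: power_mult_distrib)
    define F where "F = coeff (P n)"
    \<comment> \<open>The substitution multiplies the k-th coefficient by
      \<open>\<kappa> ^ k\<close>, so the recurrence gains one factor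
      \<open>\<kappa>\<close>.\<close>
    have rec: "(1 - a * p * X) * (1 - p * X) * F (Suc k) =
       \<kappa> * p * (1 - Y' * X) * (1 - a * b * p * Y * X) * F k"
      using coeff_little_q_jacobi_Suc[OF p a1, where m = k and n = n and b = b]
      by (simp add: F_def P_def coeff_pcompose_linear X_def Y_def Y'_def mult_ac)
    \<comment> \<open>Uses \<open>1 - inverse p * X' = - inverse p * X' * (1 - p * X)\<close> to
      expose the left side of \<open>rec\<close>.\<close>
    have "D * (1 - inverse p * X') * (\<gamma>2 * u + \<gamma>3 * U * (p * X)) * F (Suc k)
      = - D * \<gamma>2 * u * inverse p * X' * ((1 - a * p * X) * (1 - p * X) * F (Suc k))"
      using XY(1,3) unfolding ga by algebra
    also have "\<dots> = - \<gamma>5 * u ^ 2 * X' * (1 - Y' * X) * (1 - a * b * p * Y * X) * F k"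
      using XY(3) D\<kappa> unfolding rec by algebra
    \<comment> \<open>By \<open>gb\<close>, the term in \<open>F (Suc k)\<close> has become (L_n -
      L_k) times \<open>F k\<close>.\<close>
    finally have "(\<gamma>4 * U ^ 2 * X + \<gamma>5 * u ^ 2 * X' + t) * F k
        + D * (1 - inverse p * X') * (\<gamma>2 * u + \<gamma>3 * U * (p * X)) * F (Suc k)
      = (\<gamma>4 * U ^ 2 * Y + \<gamma>5 * u ^ 2 * Y' + t) * F k"
      using XY(1,2) unfolding gb by algebra
    then show "fps_nth (realize q \<nu> (G1 q c cb e m) (fps_of_poly (P n))) k =
      fps_nth (fps_const (\<gamma>4 * U ^ 2 * p ^ n + \<gamma>5 * u ^ 2 * inverse p ^ n + t) * fps_of_poly (P n)) k"
      by (simp add: t F_def X_def X'_def Y_def Y'_def)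
  qed
  then have diag: "diagonalized_by (realize q \<nu> (G1 q c cb e m)) P"
    unfolding diagonalized_by_def using triangular_basis[OF degree_P P0] by blast
  moreover have "P = little_q_jacobi p
      (- (\<gamma>3 / \<gamma>5) * (q powr (- (3 * \<nu>)) / (q - inverse q)))
      (- (\<gamma>4 / \<gamma>3) * (q - inverse q) * q powr (- \<nu> - 2))"
    if h: "\<gamma>2 / \<gamma>5 = (q - inverse q) * u"
  proof -
    have \<gamma>2: "\<gamma>2 = \<gamma>5 * (q - inverse q) * u"
      using h nz by (simp add: field_simps)
    have q': "q - inverse q \<noteq> 0" using D by auto
    have "\<kappa> = 1"
      unfolding \<kappa> \<gamma>[symmetric] u_def[symmetric] \<gamma>2 using nz q' u by simp
    moreover have "a = - (\<gamma>3 / \<gamma>5) * (U ^ 3 / (q - inverse q))"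
      unfolding a qU \<gamma>[symmetric] \<gamma>2 using u by (simp add: U_def divide_simps power2_eq_square power3_eq_cube)
    moreover have "b = - (\<gamma>4 / \<gamma>3) * (q - inverse q) * (U * inverse p)"
      unfolding b qU \<gamma>[symmetric] \<gamma>2 using nz u by (simp add: U_def power2_eq_square)
    ultimately show ?thesis
      unfolding P_def qU by simp
  qed
  ultimately show ?thesis
    by (auto simp: \<gamma> p_def u_def P_def[abs_def])
qed

end
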